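(* Let $\Theta=(a,b)$ with $-\infty\le a<b\le\infty$, and suppose $X_1,\ldots,X_n$ are i.i.d. with probability density (or mass) function $f(\cdot|\theta_0)$, $\theta_0\in\Theta$, belonging to a one-parameter exponential family $$f(x|\theta)=\exp\{k(\theta)T(x)-A(\theta)+S(x)\}\,\mathbf{1}_{\{x\in B\}},\qquad \theta\in\Theta,$$ where $B=\{x:f(x|\theta)>0\}$ does not depend on $\theta$. Assume that (A1)-(A3) and (R1)-(R4), as listed in the context, are satisfied, so that the maximum likelihood estimator $\hat\theta_n(\boldsymbol{X})$, $\boldsymbol{X}=(X_1,\ldots,X_n)$, exists and is unique. Let $\theta\mapsto D(\theta)=\frac{A'(\theta)}{k'(\theta)}$ be invertible (one-to-one) on $\Theta$. Then $q=D$ is a one-to-one twice differentiable function $q:\Theta\to\mathbb{R}$ with $q'(\theta)\ne0$ for all $\theta\in\Theta$ for which $q(\hat\theta_n(\boldsymbol{X}))$ is an average of i.i.d. terms $\frac1n\sum_{i=1}^n g(X_i)$, namely with $g=T$: $$D\left(\hat\theta_n(\boldsymbol{X})\right)=\frac1n\sum_{i=1}^n T(X_i).$$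
   Context: Here $k$ and $A$ are functions of the parameter only and $T$ and $S$ are functions of the data only. It is understood that $k'(\theta)\ne0$ on $\Theta$ (regarded in the paper as a consequence of the identifiability condition (R1)). Notation. For data $\boldsymbol{x}=(x_1,\ldots,x_n)$, the log-likelihood is $l(\theta;\boldsymbol{x})=\sum_{i=1}^n\log f(x_i|\theta)$; $l',l''$ denote derivatives with respect to $\theta$. $\hat\theta_n(\boldsymbol{x})$ is the maximizer of $\theta\mapsto l(\theta;\boldsymbol{x})$ over $\Theta$ (the MLE). $i(\theta)=\mathrm{E}_\theta\left[\left(\frac{\mathrm{d}}{\mathrm{d}\theta}\log f(X_1|\theta)\right)^2\right]$ is the expected Fisher information of one observation. $\mathbb{X}$ denotes the support of $f(\cdot|\theta)$ (here $\mathbb{X}=B$). Conditions on the log-likelihood (for every data vector $\boldsymbol{x}\in\mathbb{X}^n$): (A1) $l(\theta;\boldsymbol{x})$ is twice continuously differentiable in $\theta$, and $\theta$ varies in the open interval $(a,b)$, $a,b\in\mathbb{R}\cup\{-\infty,\infty\}$, $a<b$; (A2) $\lim_{\theta\to a}l(\theta;\boldsymbol{x})=\lim_{\theta\to b}l(\theta;\boldsymbol{x})=-\infty$; (A3) $l''(\theta;\boldsymbol{x})<0$ at every $\theta\in(a,b)$ with $l'(\theta;\boldsymbol{x})=0$. Regularity conditions: (R1) the parameter is identifiable: if $\theta\ne\theta'$ then there is $x$ with $f(x|\theta)\ne f(x|\theta')$; (R2) $f(x|\theta)$ is three times differentiable in $\theta$, the third derivative is continuous in $\theta$, and $\int f(x|\theta)\,\mathrm{d}x$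 (a sum in the discrete case) can be differentiated three times under the integral sign; (R3) for any $\theta_0\in\Theta$ there exist $\epsilon>0$ and a function $M(x)$ (both possibly depending on $\theta_0$) such that $\left|\frac{\mathrm{d}^3}{\mathrm{d}\theta^3}\log f(x|\theta)\right|\le M(x)$ for all $x\in\mathbb{X}$ and $\theta_0-\epsilon<\theta<\theta_0+\epsilon$, with $\mathrm{E}_{\theta_0}[M(X_1)]<\infty$; (R4) $i(\theta)>0$ for all $\theta\in\Theta$. *)

theory Defs
  imports "HOL-Probability.Probability"
begin

text \<open>
  A parametric family is a function \<open>f :: real \<Rightarrow> 'x \<Rightarrow> real\<close>, where \<open>f \<theta> x\<close> stands for
  $f(x|\theta)$. Densities are taken with respect to a reference measure \<open>\<nu>\<close> on the sample space:
  \<open>\<nu> = lborel\<close> gives probability densities, and a counting measure \<open>\<nu> = count_space C\<close> gives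
  probability mass functions, the integral then being a sum. A data vector of size \<open>n\<close> is a
  function on \<open>nat\<close> of which only the values below \<open>n\<close> matter.
\<close>

definition times_differentiable_on :: "nat \<Rightarrow> (real \<Rightarrow> real) \<Rightarrow> real set \<Rightarrow> bool" where
  "times_differentiable_on m g U \<longleftrightarrow>
     (\<forall>j<m. \<forall>t\<in>U. (deriv ^^ j) g differentiable (at t))"

definition log_lik :: "(real \<Rightarrow> 'x \<Rightarrow> real) \<Rightarrow> nat \<Rightarrow> (nat \<Rightarrow> 'x) \<Rightarrow> real \<Rightarrow> real" where
  "log_lik f n x \<theta> = (\<Sum>i<n. ln (f \<theta> (x i)))"

definition is_mle ::
  "(real \<Rightarrow> 'x \<Rightarrow> real) \<Rightarrow> real set \<Rightarrow> nat \<Rightarrow> (nat \<Rightarrow> 'x) \<Rightarrow> real \<Rightarrow> bool" where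
  "is_mle f \<Theta> n x \<theta> \<longleftrightarrow> is_arg_max (log_lik f n x) (\<lambda>t. t \<in> \<Theta>) \<theta>"

definition mle :: "(real \<Rightarrow> 'x \<Rightarrow> real) \<Rightarrow> real set \<Rightarrow> nat \<Rightarrow> (nat \<Rightarrow> 'x) \<Rightarrow> real" where
  "mle f \<Theta> n x = arg_max (log_lik f n x) (\<lambda>t. t \<in> \<Theta>)"

definition expect ::
  "'x measure \<Rightarrow> (real \<Rightarrow> 'x \<Rightarrow> real) \<Rightarrow> real \<Rightarrow> ('x \<Rightarrow> real) \<Rightarrow> real" where
  "expect \<nu> f \<theta> h = (LINT x|density \<nu> (\<lambda>x. ennreal (f \<theta> x)). h x)"

definition fisher_info :: "'x measure \<Rightarrow> (real \<Rightarrow> 'x \<Rightarrow> real) \<Rightarrow> real \<Rightarrow> real" where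
  "fisher_info \<nu> f \<theta> = expect \<nu> f \<theta> (\<lambda>x. (deriv (\<lambda>t. ln (f t x)) \<theta>)\<^sup>2)"

definition exponential_family ::
  "'x measure \<Rightarrow> (real \<Rightarrow> 'x \<Rightarrow> real) \<Rightarrow> real set \<Rightarrow> (real \<Rightarrow> real) \<Rightarrow> (real \<Rightarrow> real)
    \<Rightarrow> ('x \<Rightarrow> real) \<Rightarrow> ('x \<Rightarrow> real) \<Rightarrow> 'x set \<Rightarrow> bool" where
  "exponential_family \<nu> f \<Theta> k A T S B \<longleftrightarrow>
     T \<in> borel_measurable \<nu> \<and>
     (\<forall>\<theta>\<in>\<Theta>. f \<theta> \<in> borel_measurable \<nu> \<and> prob_space (density \<nu> (\<lambda>x. ennreal (f \<theta> x)))) \<and>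
     (\<forall>\<theta>\<in>\<Theta>. \<forall>x\<in>space \<nu>. f \<theta> x = exp (k \<theta> * T x - A \<theta> + S x) * indicator B x) \<and>
     (\<forall>\<theta>\<in>\<Theta>. B = {x \<in> space \<nu>. f \<theta> x > 0})"

definition cond_A1 ::
  "(real \<Rightarrow> 'x \<Rightarrow> real) \<Rightarrow> ereal \<Rightarrow> ereal \<Rightarrow> 'x set \<Rightarrow> nat \<Rightarrow> bool" where
  "cond_A1 f a b B n \<longleftrightarrow> (\<forall>x \<in> {..<n} \<rightarrow> B.
     times_differentiable_on 2 (log_lik f n x) (einterval a b) \<and>
     continuous_on (einterval a b) (deriv (deriv (log_lik f n x))))"

text \<open>The limits are taken in \<open>ereal\<close>, so that infinite endpoints need no separate treatment.\<close>

definition cond_A2 ::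
  "(real \<Rightarrow> 'x \<Rightarrow> real) \<Rightarrow> ereal \<Rightarrow> ereal \<Rightarrow> 'x set \<Rightarrow> nat \<Rightarrow> bool" where
  "cond_A2 f a b B n \<longleftrightarrow> (\<forall>x \<in> {..<n} \<rightarrow> B.
     filterlim (log_lik f n x \<circ> real_of_ereal) at_bot (at_right a) \<and>
     filterlim (log_lik f n x \<circ> real_of_ereal) at_bot (at_left b))"

definition cond_A3 ::
  "(real \<Rightarrow> 'x \<Rightarrow> real) \<Rightarrow> ereal \<Rightarrow> ereal \<Rightarrow> 'x set \<Rightarrow> nat \<Rightarrow> bool" where
  "cond_A3 f a b B n \<longleftrightarrow> (\<forall>x \<in> {..<n} \<rightarrow> B. \<forall>\<theta> \<in> einterval a b.
     deriv (log_lik f n x) \<theta> = 0 \<longrightarrow> deriv (deriv (log_lik f n x)) \<theta> < 0)"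

definition cond_R1 :: "'x measure \<Rightarrow> (real \<Rightarrow> 'x \<Rightarrow> real) \<Rightarrow> real set \<Rightarrow> bool" where
  "cond_R1 \<nu> f \<Theta> \<longleftrightarrow>
     (\<forall>\<theta>\<in>\<Theta>. \<forall>\<theta>'\<in>\<Theta>. \<theta> \<noteq> \<theta>' \<longrightarrow> (\<exists>x\<in>space \<nu>. f \<theta> x \<noteq> f \<theta>' x))"

text \<open>
  Differentiating three times under the integral sign: the derivatives of order 0 to 3 are
  integrable, and for \<open>j = 0, 1, 2\<close> the integral of the \<open>j\<close>-th derivative has as its derivative the
  integral of the derivative of order \<open>j + 1\<close>.
\<close>

definition cond_R2 :: "'x measure \<Rightarrow> (real \<Rightarrow> 'x \<Rightarrow> real) \<Rightarrow> real set \<Rightarrow> bool" where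
  "cond_R2 \<nu> f \<Theta> \<longleftrightarrow>
     (\<forall>x\<in>space \<nu>. times_differentiable_on 3 (\<lambda>t. f t x) \<Theta> \<and>
        continuous_on \<Theta> ((deriv ^^ 3) (\<lambda>t. f t x))) \<and>
     (\<forall>j\<le>3. \<forall>\<theta>\<in>\<Theta>. integrable \<nu> (\<lambda>x. (deriv ^^ j) (\<lambda>t. f t x) \<theta>)) \<and>
     (\<forall>j<3. \<forall>\<theta>\<in>\<Theta>.
        ((\<lambda>t. LINT x|\<nu>. (deriv ^^ j) (\<lambda>s. f s x) t) has_real_derivative
           (LINT x|\<nu>. (deriv ^^ Suc j) (\<lambda>s. f s x) \<theta>)) (at \<theta>))"

text \<open>The expectation of \<open>M\<close> is finite exactly if \<open>M\<close>, nonnegative on the support, is integrable.\<close>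

definition cond_R3 ::
  "'x measure \<Rightarrow> (real \<Rightarrow> 'x \<Rightarrow> real) \<Rightarrow> real set \<Rightarrow> 'x set \<Rightarrow> bool" where
  "cond_R3 \<nu> f \<Theta> B \<longleftrightarrow>
     (\<forall>\<theta>\<^sub>0\<in>\<Theta>. \<exists>\<epsilon>>0. \<exists>M :: 'x \<Rightarrow> real.
        (\<forall>x\<in>B. \<forall>\<theta>\<in>\<Theta>. \<theta>\<^sub>0 - \<epsilon> < \<theta> \<and> \<theta> < \<theta>\<^sub>0 + \<epsilon> \<longrightarrow>
           \<bar>(deriv ^^ 3) (\<lambda>t. ln (f t x)) \<theta>\<bar> \<le> M x) \<and>
        integrable (density \<nu> (\<lambda>x. ennreal (f \<theta>\<^sub>0 x))) M)"

text \<open>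
  An infinite Fisher information would be 0 here, as the Bochner integral of a non-integrable
  function; this does not occur for exponential families satisfying \<open>cond_R2\<close> and \<open>k' \<noteq> 0\<close>.
\<close>

definition cond_R4 :: "'x measure \<Rightarrow> (real \<Rightarrow> 'x \<Rightarrow> real) \<Rightarrow> real set \<Rightarrow> bool" where
  "cond_R4 \<nu> f \<Theta> \<longleftrightarrow> (\<forall>\<theta>\<in>\<Theta>. fisher_info \<nu> f \<theta> > 0)"

definition iid_vars ::
  "'w measure \<Rightarrow> 'y measure \<Rightarrow> nat \<Rightarrow> (nat \<Rightarrow> 'w \<Rightarrow> 'y) \<Rightarrow> bool" where
  "iid_vars P N n Y \<longleftrightarrow>
     prob_space.indep_vars P (\<lambda>_. N) Y {..<n} \<and>
     (\<forall>i<n. \<forall>j<n. distr P N (Y i) = distr P N (Y j))"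

definition D_map :: "(real \<Rightarrow> real) \<Rightarrow> (real \<Rightarrow> real) \<Rightarrow> real \<Rightarrow> real" where
  "D_map k A \<theta> = deriv A \<theta> / deriv k \<theta>"

end

theory Submission
  imports Defs
begin

text \<open>
  Write \<open>D = A' / k'\<close>. On data in the support the log-likelihood is, up to a term free of the
  parameter, \<open>k * (\<Sum>i<n. T (x i)) - n * A\<close>. Its critical points are therefore the solutions of
  \<open>D \<theta> = (\<Sum>i<n. T (x i)) / n\<close>, and as \<open>D\<close> is injective there is at most one. Since the
  log-likelihood tends to minus infinity at both ends of the parameter interval, it has a maximizer
  (\<open>einterval_attains_max\<close>), which is a critical point
  (\<open>exponential_family_likelihood_equation\<close>). So the maximizer is unique and satisfies the
  displayed equation. Almost surely the sample lies in the support, and the \<open>T (X i)\<close> are i.i.d.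
  as images of i.i.d. variables.

  The analytic properties of \<open>D\<close> have to be extracted from hypotheses about the densities. First,
  \<open>k\<close> and \<open>A\<close> inherit three derivatives from the densities, because identifiability
  prevents \<open>T\<close> from being constant on the support and so \<open>k\<close> and \<open>A\<close> can be solved for in terms
  of two log-densities (\<open>exponential_family_parameters_smooth\<close>). Hence \<open>D\<close> is twice differentiable.
  Secondly, differentiating the total mass twice under the integral sign gives the two Bartlett
  identities; they say that \<open>D\<close> is the mean of \<open>T\<close> and that \<open>D' = i / k'\<close> with the Fisher
  information \<open>i\<close> (\<open>deriv_D_map_eq_fisher_info\<close>). Since \<open>i\<close> is positive, \<open>D'\<close> does not vanish.
\<close>

section \<open>Iterated differentiability\<close>

lemma times_differentiable_on_0 [simp]: "times_differentiable_on 0 g U"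
  by (simp add: times_differentiable_on_def)

lemma times_differentiable_on_Suc:
  "times_differentiable_on (Suc m) g U \<longleftrightarrow>
     (\<forall>t\<in>U. g differentiable (at t)) \<and> times_differentiable_on m (deriv g) U"
  by (auto simp: times_differentiable_on_def less_Suc_eq_0_disj funpow_Suc_right
        simp del: funpow.simps)

lemma times_differentiable_on_le:
  "times_differentiable_on m g U \<Longrightarrow> l \<le> m \<Longrightarrow> times_differentiable_on l g U"
  by (auto simp: times_differentiable_on_def)

lemma times_differentiable_on_imp_DERIV:
  assumes "times_differentiable_on m g U" "0 < m" "t \<in> U"
  shows "(g has_real_derivative deriv g t) (at t)"
proof -
  have "(deriv ^^ 0) g differentiable (at t)"
    using assms unfolding times_differentiable_on_def by blast
  then show ?thesis
    by (simp add: DERIV_deriv_iff_real_differentiable)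
qed

lemma times_differentiable_on_cong:
  assumes "open U" "times_differentiable_on m g U" "\<And>t. t \<in> U \<Longrightarrow> h t = g t"
  shows "times_differentiable_on m h U"
  using assms(2,3)
proof (induction m arbitrary: g h)
  case (Suc m)
  have ev: "\<forall>\<^sub>F s in nhds t. h s = g s" if "t \<in> U" for t
    using eventually_nhds_in_open[OF \<open>open U\<close> that] Suc.prems(2) by (auto elim: eventually_mono)
  have "(h has_real_derivative deriv g t) (at t)" if "t \<in> U" for t
    using times_differentiable_on_imp_DERIV[OF Suc.prems(1) _ that]
      DERIV_cong_ev[OF refl ev[OF that] refl] by simp
  moreover have "times_differentiable_on m (deriv h) U"
  proof (rule Suc.IH)
    show "times_differentiable_on m (deriv g) U"
      using Suc.prems(1) by (simp add: times_differentiable_on_Suc)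
    show "deriv h t = deriv g t" if "t \<in> U" for t
      by (rule deriv_cong_ev[OF ev[OF that] refl])
  qed
  ultimately show ?case
    unfolding times_differentiable_on_Suc by (meson real_differentiable_def)
qed simp

text \<open>
  The form in which the closure properties below are proved by induction: it suffices to exhibit
  a derivative on the open set \<open>U\<close> that is itself sufficiently often differentiable there.
\<close>

lemma times_differentiable_on_SucI:
  assumes "open U" "\<And>t. t \<in> U \<Longrightarrow> (g has_real_derivative g' t) (at t)"
    and "times_differentiable_on m g' U"
  shows "times_differentiable_on (Suc m) g U"
  unfolding times_differentiable_on_Suc
proof
  show "\<forall>t\<in>U. g differentiable (at t)"
    using assms(2) by (meson real_differentiable_def)
  show "times_differentiable_on m (deriv g) U"
    using assms(1,3) by (rule times_differentiable_on_cong) (simp add: assms(2) DERIV_imp_deriv)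
qed

lemma times_differentiable_on_const: "open U \<Longrightarrow> times_differentiable_on m (\<lambda>_. c) U"
  by (induction m arbitrary: c) (auto intro!: times_differentiable_on_SucI derivative_eq_intros)

lemma times_differentiable_on_add:
  assumes "open U" "times_differentiable_on m g U" "times_differentiable_on m h U"
  shows "times_differentiable_on m (\<lambda>t. g t + h t) U"
  using assms(2,3)
proof (induction m arbitrary: g h)
  case (Suc m)
  note dg = times_differentiable_on_imp_DERIV[OF Suc.prems(1)]
   and dh = times_differentiable_on_imp_DERIV[OF Suc.prems(2)]
  show ?case
  proof (rule times_differentiable_on_SucI[OF \<open>open U\<close>])
    show "((\<lambda>t. g t + h t) has_real_derivative deriv g t + deriv h t) (at t)" if "t \<in> U" for t
      using dg dh that by (auto intro!: derivative_eq_intros)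
    show "times_differentiable_on m (\<lambda>t. deriv g t + deriv h t) U"
      using Suc by (simp add: times_differentiable_on_Suc)
  qed
qed simp

lemma times_differentiable_on_mult:
  assumes "open U" "times_differentiable_on m g U" "times_differentiable_on m h U"
  shows "times_differentiable_on m (\<lambda>t. g t * h t) U"
  using assms(2,3)
proof (induction m arbitrary: g h)
  case (Suc m)
  note dg = times_differentiable_on_imp_DERIV[OF Suc.prems(1)]
   and dh = times_differentiable_on_imp_DERIV[OF Suc.prems(2)]
  show ?case
  proof (rule times_differentiable_on_SucI[OF \<open>open U\<close>])
    show "((\<lambda>t. g t * h t) has_real_derivative deriv g t * h t + g t * deriv h t) (at t)"
      if "t \<in> U" for t
      using dg dh that by (auto intro!: derivative_eq_intros)
    have "times_differentiable_on m g U" "times_differentiable_on m h U"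
      using Suc.prems by (auto elim: times_differentiable_on_le)
    then show "times_differentiable_on m (\<lambda>t. deriv g t * h t + g t * deriv h t) U"
      using Suc by (simp add: times_differentiable_on_Suc times_differentiable_on_add \<open>open U\<close>)
  qed
qed simp

lemma times_differentiable_on_inverse:
  assumes "open U" "times_differentiable_on m g U" "\<And>t. t \<in> U \<Longrightarrow> g t \<noteq> 0"
  shows "times_differentiable_on m (\<lambda>t. inverse (g t)) U"
  using assms(2)
proof (induction m)
  case (Suc m)
  note dg = times_differentiable_on_imp_DERIV[OF Suc.prems]
  show ?case
  proof (rule times_differentiable_on_SucI[OF \<open>open U\<close>])
    show "((\<lambda>t. inverse (g t)) has_real_derivative
            (- 1) * (deriv g t * (inverse (g t) * inverse (g t)))) (at t)" if "t \<in> U" for t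
      using dg that assms(3) by (auto intro!: derivative_eq_intros)
    have "times_differentiable_on m g U" "times_differentiable_on m (deriv g) U"
      using times_differentiable_on_le[OF Suc.prems, of m] Suc.prems
      by (simp_all add: times_differentiable_on_Suc)
    with Suc.IH show "times_differentiable_on m
        (\<lambda>t. (- 1) * (deriv g t * (inverse (g t) * inverse (g t)))) U"
      by (intro times_differentiable_on_mult times_differentiable_on_const \<open>open U\<close>) auto
  qed
qed simp

lemma times_differentiable_on_ln:
  assumes "open U" "times_differentiable_on m g U" "\<And>t. t \<in> U \<Longrightarrow> g t > 0"
  shows "times_differentiable_on m (\<lambda>t. ln (g t)) U"
proof (cases m)
  case (Suc l)
  note dg = times_differentiable_on_imp_DERIV[OF assms(2)]
  have l: "times_differentiable_on l g U" "times_differentiable_on l (deriv g) U"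
    using times_differentiable_on_le[OF assms(2), of l] assms(2)
    by (simp_all add: Suc times_differentiable_on_Suc)
  show ?thesis
    unfolding Suc
  proof (rule times_differentiable_on_SucI[OF \<open>open U\<close>])
    show "((\<lambda>t. ln (g t)) has_real_derivative deriv g t * inverse (g t)) (at t)" if "t \<in> U" for t
      using dg that assms(3) Suc by (auto intro!: derivative_eq_intros simp: field_simps)
    show "times_differentiable_on l (\<lambda>t. deriv g t * inverse (g t)) U"
      using l assms(3)
      by (intro times_differentiable_on_mult times_differentiable_on_inverse \<open>open U\<close>)
        (auto simp: less_imp_neq[symmetric])
  qed
qed simp

section \<open>Regularity of the exponential family\<close>

lemma exponential_family_density:
  assumes "exponential_family \<nu> f \<Theta> k A T S B" "\<theta> \<in> \<Theta>" "x \<in> space \<nu>"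
  shows "f \<theta> x = exp (k \<theta> * T x - A \<theta> + S x) * indicator B x"
  using assms unfolding exponential_family_def by blast

lemma exponential_family_support:
  assumes "exponential_family \<nu> f \<Theta> k A T S B" "\<theta> \<in> \<Theta>"
  shows "B \<subseteq> space \<nu>" "B \<in> sets \<nu>" "x \<in> B \<Longrightarrow> f \<theta> x > 0"
proof -
  have B: "B = {x \<in> space \<nu>. f \<theta> x > 0}" and [measurable]: "f \<theta> \<in> borel_measurable \<nu>"
    using assms unfolding exponential_family_def by blast+
  show "B \<subseteq> space \<nu>"
    by (subst B) auto
  show "x \<in> B \<Longrightarrow> f \<theta> x > 0"
    by (subst (asm) B) auto
  show "B \<in> sets \<nu>"
    by (subst B) measurable
qed

lemma exponential_family_integral:
  assumes "exponential_family \<nu> f \<Theta> k A T S B" "\<theta> \<in> \<Theta>"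
  shows "(LINT x|\<nu>. f \<theta> x) = 1"
proof -
  have [measurable]: "f \<theta> \<in> borel_measurable \<nu>"
    and prob: "prob_space (density \<nu> (\<lambda>x. ennreal (f \<theta> x)))"
    using assms unfolding exponential_family_def by blast+
  have nonneg: "AE x in \<nu>. 0 \<le> f \<theta> x"
    by (rule AE_I2) (simp add: exponential_family_density[OF assms])
  have "(\<integral>\<^sup>+x. ennreal (f \<theta> x) \<partial>\<nu>) = emeasure (density \<nu> (\<lambda>x. ennreal (f \<theta> x))) (space \<nu>)"
    by (simp add: emeasure_density cong: nn_integral_cong)
  also have "\<dots> = 1"
    using prob_space.emeasure_space_1[OF prob] by simp
  finally have "(\<integral>\<^sup>+x. ennreal (f \<theta> x) \<partial>\<nu>) = 1" .
  then show ?thesis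
    using nonneg by (simp add: integral_eq_nn_integral)
qed

text \<open>
  If \<open>T\<close> were constant on the support, any two members of the family would be proportional, and
  two proportional probability densities are equal, against identifiability.
\<close>

lemma exponential_family_statistic_not_constant:
  assumes fam: "exponential_family \<nu> f \<Theta> k A T S B" and R1: "cond_R1 \<nu> f \<Theta>"
    and \<theta>: "\<theta> \<in> \<Theta>" "\<theta>' \<in> \<Theta>" "\<theta> \<noteq> \<theta>'"
  obtains x y where "x \<in> B" "y \<in> B" "T x \<noteq> T y"
proof (rule ccontr)
  assume "\<not> thesis"
  then have "\<exists>c. \<forall>x\<in>B. T x = c"
    using that by blast
  then obtain c where c: "\<And>x. x \<in> B \<Longrightarrow> T x = c"
    by blast
  define r where "r = exp ((k \<theta>' - k \<theta>) * c - (A \<theta>' - A \<theta>))"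
  have scaled: "f \<theta>' x = r * f \<theta> x" if "x \<in> space \<nu>" for x
  proof (cases "x \<in> B")
    case True
    then have "f \<theta>' x = exp (k \<theta>' * c - A \<theta>' + S x)" "f \<theta> x = exp (k \<theta> * c - A \<theta> + S x)"
      using \<theta> that c by (simp_all add: exponential_family_density[OF fam])
    then show ?thesis
      by (simp add: r_def algebra_simps flip: exp_add)
  next
    case False
    then show ?thesis
      using \<theta> that by (simp add: exponential_family_density[OF fam])
  qed
  have "(LINT x|\<nu>. f \<theta>' x) = (LINT x|\<nu>. r * f \<theta> x)"
    by (rule Bochner_Integration.integral_cong) (simp_all add: scaled)
  then have "r = 1"
    using exponential_family_integral[OF fam] \<theta> by simp
  with scaled R1 \<theta> show False
    unfolding cond_R1_def by fastforce
qed

text \<open>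
  Smoothness is assumed of the densities only. With \<open>T x \<noteq> T y\<close>, the identity
  \<open>ln (f \<theta> x) = k \<theta> * T x - A \<theta> + S x\<close> at two points of the support is a regular linear system for
  \<open>k \<theta>\<close> and \<open>A \<theta>\<close>, so both are linear combinations of two log-densities.
\<close>

lemma exponential_family_parameters_smooth:
  assumes fam: "exponential_family \<nu> f \<Theta> k A T S B" and "open \<Theta>"
    and R1: "cond_R1 \<nu> f \<Theta>"
    and R2: "\<And>x. x \<in> B \<Longrightarrow> times_differentiable_on m (\<lambda>t. f t x) \<Theta>"
    and \<theta>: "\<theta> \<in> \<Theta>" "\<theta>' \<in> \<Theta>" "\<theta> \<noteq> \<theta>'"
  shows "times_differentiable_on m k \<Theta>" "times_differentiable_on m A \<Theta>"
proof -
  obtain x y where xy: "x \<in> B" "y \<in> B" "T x \<noteq> T y"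
    using exponential_family_statistic_not_constant[OF fam R1 \<theta>] .
  have ln: "ln (f t z) = k t * T z - A t + S z" if "t \<in> \<Theta>" "z \<in> B" for t z
    using exponential_family_density[OF fam that(1), of z]
      exponential_family_support(1)[OF fam that(1)] that(2) by auto
  have smooth: "times_differentiable_on m (\<lambda>t. ln (f t z)) \<Theta>" if "z \<in> B" for z
    using R2[OF that] exponential_family_support(3)[OF fam _ that]
    by (intro times_differentiable_on_ln \<open>open \<Theta>\<close>) auto
  show k: "times_differentiable_on m k \<Theta>"
  proof (rule times_differentiable_on_cong[OF \<open>open \<Theta>\<close>])
    show "times_differentiable_on m
        (\<lambda>t. inverse (T x - T y) * ((ln (f t x) + (-1) * ln (f t y)) + (S y - S x))) \<Theta>"
      by (intro times_differentiable_on_add times_differentiable_on_mult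
          times_differentiable_on_const smooth \<open>open \<Theta>\<close> xy)
    show "k t = inverse (T x - T y) * ((ln (f t x) + (-1) * ln (f t y)) + (S y - S x))"
      if "t \<in> \<Theta>" for t
    proof -
      have "(ln (f t x) + (-1) * ln (f t y)) + (S y - S x) = (T x - T y) * k t"
        unfolding ln[OF that xy(1)] ln[OF that xy(2)] by (simp add: algebra_simps)
      then show ?thesis
        using xy(3) by simp
    qed
  qed
  show "times_differentiable_on m A \<Theta>"
  proof (rule times_differentiable_on_cong[OF \<open>open \<Theta>\<close>])
    show "times_differentiable_on m (\<lambda>t. k t * T x + ((-1) * ln (f t x) + S x)) \<Theta>"
      by (intro times_differentiable_on_add times_differentiable_on_mult
          times_differentiable_on_const smooth \<open>open \<Theta>\<close> xy k)
    show "A t = k t * T x + ((-1) * ln (f t x) + S x)" if "t \<in> \<Theta>" for t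
      unfolding ln[OF that xy(1)] by simp
  qed
qed

section \<open>The derivative of the mean-value map\<close>

text \<open>
  Inside the sample space but outside the support the density vanishes for every parameter, so
  these two formulas hold there as well; no case distinction is left in the integrals below.
\<close>

lemma exponential_family_deriv:
  assumes fam: "exponential_family \<nu> f \<Theta> k A T S B" and "open \<Theta>"
    and k: "times_differentiable_on 2 k \<Theta>" and A: "times_differentiable_on 2 A \<Theta>"
    and \<theta>: "\<theta> \<in> \<Theta>" and x: "x \<in> space \<nu>"
  shows "deriv (\<lambda>t. f t x) \<theta> = f \<theta> x * (deriv k \<theta> * T x - deriv A \<theta>)"
    and "deriv (deriv (\<lambda>t. f t x)) \<theta> = f \<theta> x *
      ((deriv k \<theta> * T x - deriv A \<theta>)\<^sup>2 + (deriv (deriv k) \<theta> * T x - deriv (deriv A) \<theta>))"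
proof -
  have k': "times_differentiable_on 1 (deriv k) \<Theta>" and A': "times_differentiable_on 1 (deriv A) \<Theta>"
    using k A by (simp_all add: numeral_2_eq_2 times_differentiable_on_Suc)
  have ev: "\<forall>\<^sub>F s in nhds t. s \<in> \<Theta>" if "t \<in> \<Theta>" for t
    using eventually_nhds_in_open[OF \<open>open \<Theta>\<close> that] .
  have D: "((\<lambda>t. f t x) has_real_derivative f t x * (deriv k t * T x - deriv A t)) (at t)"
    if t: "t \<in> \<Theta>" for t
  proof -
    have "((\<lambda>t. exp (k t * T x - A t + S x) * indicator B x) has_real_derivative
        (exp (k t * T x - A t + S x) * indicator B x) * (deriv k t * T x - deriv A t)) (at t)"
      using times_differentiable_on_imp_DERIV[OF k _ t] times_differentiable_on_imp_DERIV[OF A _ t]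
      by (auto intro!: derivative_eq_intros)
    moreover have "\<forall>\<^sub>F s in nhds t. f s x = exp (k s * T x - A s + S x) * indicator B x"
      using ev[OF t] by eventually_elim (simp add: exponential_family_density[OF fam _ x])
    ultimately show ?thesis
      unfolding exponential_family_density[OF fam t x] by (subst DERIV_cong_ev[OF refl _ refl])
  qed
  then show "deriv (\<lambda>t. f t x) \<theta> = f \<theta> x * (deriv k \<theta> * T x - deriv A \<theta>)"
    using \<theta> by (simp add: DERIV_imp_deriv)
  have "\<forall>\<^sub>F t in nhds \<theta>. deriv (\<lambda>t. f t x) t = f t x * (deriv k t * T x - deriv A t)"
    using ev[OF \<theta>] by eventually_elim (simp add: D DERIV_imp_deriv)
  then have "deriv (deriv (\<lambda>t. f t x)) \<theta> = deriv (\<lambda>t. f t x * (deriv k t * T x - deriv A t)) \<theta>"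
    by (rule deriv_cong_ev) simp
  also have "\<dots> = f \<theta> x *
      ((deriv k \<theta> * T x - deriv A \<theta>)\<^sup>2 + (deriv (deriv k) \<theta> * T x - deriv (deriv A) \<theta>))"
    using D[OF \<theta>] times_differentiable_on_imp_DERIV[OF k' _ \<theta>]
      times_differentiable_on_imp_DERIV[OF A' _ \<theta>]
    by (intro DERIV_imp_deriv)
      (auto intro!: derivative_eq_intros simp: power2_eq_square algebra_simps)
  finally show "deriv (deriv (\<lambda>t. f t x)) \<theta> = f \<theta> x *
      ((deriv k \<theta> * T x - deriv A \<theta>)\<^sup>2 + (deriv (deriv k) \<theta> * T x - deriv (deriv A) \<theta>))" .
qed

text \<open>
  The total mass of the density is 1 for every parameter. Differentiating this constant under the
  integral sign gives 0, and differentiating that constant gives 0 again.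
\<close>

lemma exponential_family_integral_derivs:
  assumes fam: "exponential_family \<nu> f \<Theta> k A T S B" and "open \<Theta>"
    and R2: "cond_R2 \<nu> f \<Theta>" and \<theta>: "\<theta> \<in> \<Theta>"
  shows "(LINT x|\<nu>. deriv (\<lambda>t. f t x) \<theta>) = 0"
    and "(LINT x|\<nu>. deriv (deriv (\<lambda>t. f t x)) \<theta>) = 0"
proof -
  have R2_deriv: "((\<lambda>t. LINT x|\<nu>. (deriv ^^ j) (\<lambda>s. f s x) t) has_real_derivative
      (LINT x|\<nu>. (deriv ^^ Suc j) (\<lambda>s. f s x) t)) (at t)" if "j < 3" "t \<in> \<Theta>" for j t
    using R2 that unfolding cond_R2_def by blast
  have const: "D = 0" if "(g has_real_derivative D) (at t)" "t \<in> \<Theta>" "\<And>s. s \<in> \<Theta> \<Longrightarrow> g s = c"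
    for g :: "real \<Rightarrow> real" and c D t
  proof -
    have "\<forall>\<^sub>F s in nhds t. g s = c"
      using eventually_nhds_in_open[OF \<open>open \<Theta>\<close> that(2)] that(3) by (auto elim: eventually_mono)
    then have "(g has_real_derivative 0) (at t)"
      using DERIV_cong_ev[OF refl, of g "\<lambda>_. c"] by simp
    then show ?thesis
      using that(1) DERIV_unique by blast
  qed
  have 1: "(LINT x|\<nu>. deriv (\<lambda>s. f s x) t) = 0" if "t \<in> \<Theta>" for t
    using const[OF R2_deriv[of 0 t] that] exponential_family_integral[OF fam] that by simp
  then show "(LINT x|\<nu>. deriv (\<lambda>t. f t x) \<theta>) = 0"
    using \<theta> .
  show "(LINT x|\<nu>. deriv (deriv (\<lambda>t. f t x)) \<theta>) = 0"
    using const[OF R2_deriv[of 1 \<theta>] \<theta>] 1 \<theta> by simp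
qed

lemma exponential_family_fisher_info:
  assumes fam: "exponential_family \<nu> f \<Theta> k A T S B" and "open \<Theta>"
    and k: "times_differentiable_on 2 k \<Theta>" and A: "times_differentiable_on 2 A \<Theta>"
    and \<theta>: "\<theta> \<in> \<Theta>"
  shows "fisher_info \<nu> f \<theta> = (LINT x|\<nu>. f \<theta> x * (deriv k \<theta> * T x - deriv A \<theta>)\<^sup>2)"
proof -
  have [measurable]: "f \<theta> \<in> borel_measurable \<nu>" "T \<in> borel_measurable \<nu>" "B \<in> sets \<nu>"
    using fam \<theta> exponential_family_support(2)[OF fam \<theta>] unfolding exponential_family_def by blast+
  note support = exponential_family_support[OF fam]
  have f_outside: "f t x = 0" if "t \<in> \<Theta>" "x \<in> space \<nu>" "x \<notin> B" for t x
    using exponential_family_density[OF fam that(1,2)] that(3) by simp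
  have ev: "\<forall>\<^sub>F s in nhds \<theta>. s \<in> \<Theta>"
    using eventually_nhds_in_open[OF \<open>open \<Theta>\<close> \<theta>] .
  have score: "deriv (\<lambda>t. ln (f t x)) \<theta> = indicator B x * (deriv k \<theta> * T x - deriv A \<theta>)"
    if x: "x \<in> space \<nu>" for x
  proof -
    have "\<forall>\<^sub>F s in nhds \<theta>. ln (f s x) = indicator B x * (k s * T x - A s + S x)"
      using ev by eventually_elim (auto simp: exponential_family_density[OF fam _ x] indicator_def)
    then have "deriv (\<lambda>t. ln (f t x)) \<theta> = deriv (\<lambda>s. indicator B x * (k s * T x - A s + S x)) \<theta>"
      by (rule deriv_cong_ev) simp
    also have "\<dots> = indicator B x * (deriv k \<theta> * T x - deriv A \<theta>)"
      using times_differentiable_on_imp_DERIV[OF k _ \<theta>] times_differentiable_on_imp_DERIV[OF A _ \<theta>]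
      by (intro DERIV_imp_deriv) (auto intro!: derivative_eq_intros)
    finally show ?thesis .
  qed
  have "fisher_info \<nu> f \<theta> = (LINT x|density \<nu> (\<lambda>x. ennreal (f \<theta> x)).
      (indicator B x * (deriv k \<theta> * T x - deriv A \<theta>))\<^sup>2)"
    unfolding fisher_info_def expect_def
    by (rule Bochner_Integration.integral_cong) (simp_all add: score)
  also have "\<dots> = (LINT x|\<nu>. f \<theta> x * (indicator B x * (deriv k \<theta> * T x - deriv A \<theta>))\<^sup>2)"
    by (subst integral_density) (auto simp: exponential_family_density[OF fam \<theta>])
  also have "\<dots> = (LINT x|\<nu>. f \<theta> x * (deriv k \<theta> * T x - deriv A \<theta>)\<^sup>2)"
    by (rule Bochner_Integration.integral_cong) (auto simp: indicator_def f_outside \<theta>)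
  finally show ?thesis .
qed

text \<open>
  The score \<open>k' T - A'\<close> has mean 0, so \<open>D\<close> is the mean of \<open>T\<close>. The vanishing integral of the
  second derivative of the density reads \<open>i + k'' D - A'' = 0\<close>, and the quotient rule gives
  \<open>D' = (A'' - D k'') / k'\<close>. Integrability of \<open>T\<close> and of the squared score under the density comes
  from that of the first two derivatives of the density, as \<open>k' \<noteq> 0\<close>.
\<close>

lemma deriv_D_map_eq_fisher_info:
  assumes fam: "exponential_family \<nu> f \<Theta> k A T S B" and "open \<Theta>"
    and k: "times_differentiable_on 2 k \<Theta>" and A: "times_differentiable_on 2 A \<Theta>"
    and R2: "cond_R2 \<nu> f \<Theta>" and \<theta>: "\<theta> \<in> \<Theta>" and nz: "deriv k \<theta> \<noteq> 0"
  shows "deriv (D_map k A) \<theta> = fisher_info \<nu> f \<theta> / deriv k \<theta>"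
proof -
  let ?k1 = "deriv k \<theta>" and ?k2 = "deriv (deriv k) \<theta>"
  let ?A1 = "deriv A \<theta>" and ?A2 = "deriv (deriv A) \<theta>"
  let ?score = "\<lambda>x. ?k1 * T x - ?A1"
  note deriv_f = exponential_family_deriv[OF fam \<open>open \<Theta>\<close> k A \<theta>]
  note int_f = exponential_family_integral_derivs[OF fam \<open>open \<Theta>\<close> R2 \<theta>]
  have R2_int: "integrable \<nu> (\<lambda>x. (deriv ^^ j) (\<lambda>t. f t x) \<theta>)" if "j \<le> 3" for j
    using R2 \<theta> that unfolding cond_R2_def by blast
  have int0: "integrable \<nu> (f \<theta>)"
    using R2_int[of 0] by simp
  have int1: "integrable \<nu> (\<lambda>x. f \<theta> x * ?score x)"
    using R2_int[of 1] by (simp add: deriv_f cong: Bochner_Integration.integrable_cong)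
  have int2: "integrable \<nu> (\<lambda>x. f \<theta> x * ((?score x)\<^sup>2 + (?k2 * T x - ?A2)))"
    using R2_int[of 2]
    by (simp add: deriv_f numeral_2_eq_2 cong: Bochner_Integration.integrable_cong)
  have "integrable \<nu> (\<lambda>x. (f \<theta> x * ?score x + ?A1 * f \<theta> x) / ?k1)"
    using int0 int1 by (intro integrable_divide Bochner_Integration.integrable_add) auto
  then have intT: "integrable \<nu> (\<lambda>x. f \<theta> x * T x)"
    using nz by (simp add: field_simps)
  have "integrable \<nu> (\<lambda>x. f \<theta> x * ((?score x)\<^sup>2 + (?k2 * T x - ?A2))
      - (?k2 * (f \<theta> x * T x) - ?A2 * f \<theta> x))"
    using int0 int2 intT by (intro Bochner_Integration.integrable_diff) auto
  then have int_sq: "integrable \<nu> (\<lambda>x. f \<theta> x * (?score x)\<^sup>2)"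
    by (simp add: algebra_simps)
  define m where "m = (LINT x|\<nu>. f \<theta> x * T x)"
  have "0 = (LINT x|\<nu>. ?k1 * (f \<theta> x * T x) - ?A1 * f \<theta> x)"
    using int_f(1) by (simp add: deriv_f algebra_simps cong: Bochner_Integration.integral_cong)
  also have "\<dots> = ?k1 * m - ?A1"
    using int0 intT exponential_family_integral[OF fam \<theta>] by (simp add: m_def)
  finally have m: "m = ?A1 / ?k1"
    using nz by (simp add: field_simps)
  have "0 = (LINT x|\<nu>. f \<theta> x * (?score x)\<^sup>2 + (?k2 * (f \<theta> x * T x) - ?A2 * f \<theta> x))"
    using int_f(2) by (simp add: deriv_f algebra_simps cong: Bochner_Integration.integral_cong)
  also have "\<dots> = fisher_info \<nu> f \<theta> + (?k2 * m - ?A2)"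
    using int0 intT int_sq exponential_family_integral[OF fam \<theta>]
    by (simp add: m_def exponential_family_fisher_info[OF fam \<open>open \<Theta>\<close> k A \<theta>])
  finally have info: "fisher_info \<nu> f \<theta> = ?A2 - ?k2 * m"
    by simp
  have "times_differentiable_on 1 (deriv k) \<Theta>" "times_differentiable_on 1 (deriv A) \<Theta>"
    using k A by (simp_all add: numeral_2_eq_2 times_differentiable_on_Suc)
  then have "(deriv k has_real_derivative ?k2) (at \<theta>)" "(deriv A has_real_derivative ?A2) (at \<theta>)"
    using times_differentiable_on_imp_DERIV \<theta> zero_less_one by blast+
  then have "((\<lambda>t. deriv A t / deriv k t) has_real_derivative
      (?A2 * ?k1 - ?A1 * ?k2) / (?k1 * ?k1)) (at \<theta>)"
    using nz by (intro DERIV_divide)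
  moreover have "(?A2 * ?k1 - ?A1 * ?k2) / (?k1 * ?k1) = fisher_info \<nu> f \<theta> / ?k1"
    using nz by (simp add: info m field_simps)
  ultimately show ?thesis
    unfolding D_map_def[abs_def] by (simp add: DERIV_imp_deriv)
qed

section \<open>Existence of the maximum likelihood estimator and the likelihood equation\<close>

text \<open>
  Near the endpoints the function lies below its value at a given interior point, so a maximum
  over a compact subinterval is a maximum over the whole interval.
\<close>

lemma einterval_attains_max:
  fixes l :: "real \<Rightarrow> real" and a b :: ereal
  assumes cont: "continuous_on (einterval a b) l" and t0: "t0 \<in> einterval a b"
    and a: "filterlim (l \<circ> real_of_ereal) at_bot (at_right a)"
    and b: "filterlim (l \<circ> real_of_ereal) at_bot (at_left b)"
  shows "\<exists>t. is_arg_max l (\<lambda>t. t \<in> einterval a b) t"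
proof -
  have ab: "a < ereal t0" "ereal t0 < b"
    using t0 by (auto simp: einterval_def)
  have "\<forall>\<^sub>F y in at_right a. l (real_of_ereal y) < l t0"
    using a unfolding filterlim_at_bot_dense comp_def by blast
  then obtain c where c: "a < c" "\<And>y. a < y \<Longrightarrow> y < c \<Longrightarrow> l (real_of_ereal y) < l t0"
    unfolding eventually_at_right[OF ab(1)] by blast
  have "\<forall>\<^sub>F y in at_left b. l (real_of_ereal y) < l t0"
    using b unfolding filterlim_at_bot_dense comp_def by blast
  then obtain d where d: "d < b" "\<And>y. d < y \<Longrightarrow> y < b \<Longrightarrow> l (real_of_ereal y) < l t0"
    unfolding eventually_at_left[OF ab(2)] by blast
  obtain r where r: "min c (ereal t0) = ereal r"
    using ab c(1) by (cases "min c (ereal t0)") (auto simp: min_def split: if_splits)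
  obtain s where s: "max d (ereal t0) = ereal s"
    using ab d(1) by (cases "max d (ereal t0)") (auto simp: max_def split: if_splits)
  have "a < ereal r" "ereal s < b"
    using ab c(1) d(1) by (simp_all flip: r s)
  then have sub: "{r..s} \<subseteq> einterval a b"
    unfolding einterval_def
    by (auto intro: less_le_trans[of a "ereal r"] le_less_trans[of _ "ereal s" b])
  have "ereal r \<le> ereal t0" "ereal t0 \<le> ereal s"
    unfolding r[symmetric] s[symmetric] by auto
  then have t0_rs: "t0 \<in> {r..s}"
    by simp
  obtain t where t: "t \<in> {r..s}" "\<And>u. u \<in> {r..s} \<Longrightarrow> l u \<le> l t"
    using continuous_attains_sup[OF compact_Icc _ continuous_on_subset[OF cont sub]] t0_rs by blast
  have "l u \<le> l t" if u: "u \<in> einterval a b" for u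
  proof (cases "u \<in> {r..s}")
    case False
    then have "ereal u < min c (ereal t0) \<or> max d (ereal t0) < ereal u"
      unfolding r s by auto
    then have "l (real_of_ereal (ereal u)) < l t0"
      using u by (intro disjE[OF _ c(2) d(2)]) (auto simp: einterval_def)
    then show ?thesis
      using t(2)[OF t0_rs] by simp
  qed (use t in blast)
  then have "is_arg_max l (\<lambda>t. t \<in> einterval a b) t"
    using t(1) sub unfolding is_arg_max_linorder by blast
  then show ?thesis ..
qed

text \<open>
  At an interior maximum the derivative \<open>k' * (\<Sum>i<n. T (x i)) - n * A'\<close> of the log-likelihood
  vanishes; dividing by \<open>n k'\<close> yields the equation.
\<close>

lemma exponential_family_likelihood_equation:
  assumes fam: "exponential_family \<nu> f \<Theta> k A T S B" and "open \<Theta>"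
    and k: "times_differentiable_on 2 k \<Theta>" and A: "times_differentiable_on 2 A \<Theta>"
    and x: "x \<in> {..<n} \<rightarrow> B" and "n \<ge> 1"
    and max: "is_mle f \<Theta> n x \<theta>" and nz: "deriv k \<theta> \<noteq> 0"
  shows "D_map k A \<theta> = (\<Sum>i<n. T (x i)) / real n"
proof -
  have \<theta>: "\<theta> \<in> \<Theta>" and le: "\<And>t. t \<in> \<Theta> \<Longrightarrow> log_lik f n x t \<le> log_lik f n x \<theta>"
    using max by (auto simp: is_mle_def is_arg_max_linorder)
  have log_lik: "log_lik f n x t = (\<Sum>i<n. k t * T (x i) - A t + S (x i))" if "t \<in> \<Theta>" for t
    unfolding log_lik_def
  proof (intro sum.cong refl)
    fix i assume "i \<in> {..<n}"
    then have "x i \<in> B" "x i \<in> space \<nu>"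
      using x exponential_family_support(1)[OF fam \<theta>] by auto
    then show "ln (f t (x i)) = k t * T (x i) - A t + S (x i)"
      using exponential_family_density[OF fam that] by simp
  qed
  obtain e where e: "e > 0" "ball \<theta> e \<subseteq> \<Theta>"
    using \<open>open \<Theta>\<close> \<theta> openE by blast
  have "((\<lambda>t. \<Sum>i<n. k t * T (x i) - A t + S (x i)) has_real_derivative
      (\<Sum>i<n. deriv k \<theta> * T (x i) - deriv A \<theta>)) (at \<theta>)"
    using times_differentiable_on_imp_DERIV[OF k _ \<theta>] times_differentiable_on_imp_DERIV[OF A _ \<theta>]
    by (auto intro!: derivative_eq_intros)
  then have "(\<Sum>i<n. deriv k \<theta> * T (x i) - deriv A \<theta>) = 0"
  proof (rule DERIV_local_max[OF _ \<open>e > 0\<close>], intro allI impI)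
    fix t assume "\<bar>\<theta> - t\<bar> < e"
    then have "t \<in> \<Theta>"
      using e(2) by (auto simp: dist_real_def)
    then show "(\<Sum>i<n. k t * T (x i) - A t + S (x i)) \<le> (\<Sum>i<n. k \<theta> * T (x i) - A \<theta> + S (x i))"
      using le \<theta> by (simp flip: log_lik)
  qed
  then have "deriv k \<theta> * (\<Sum>i<n. T (x i)) = real n * deriv A \<theta>"
    by (simp add: sum_subtractf sum_distrib_left)
  then show ?thesis
    using nz \<open>n \<ge> 1\<close> by (simp add: D_map_def field_simps)
qed

section \<open>Random samples and the distribution of the statistic\<close>

lemma iid_vars_compose:
  assumes "prob_space P" "iid_vars P N n X" and g: "g \<in> measurable N L"
  shows "iid_vars P L n (\<lambda>i \<omega>. g (X i \<omega>))"
proof -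
  interpret prob_space P by fact
  have indep: "indep_vars (\<lambda>_. N) X {..<n}"
    and distr: "\<And>i j. i < n \<Longrightarrow> j < n \<Longrightarrow> distr P N (X i) = distr P N (X j)"
    using assms(2) unfolding iid_vars_def by blast+
  have indep_g: "indep_vars (\<lambda>_. L) (\<lambda>i \<omega>. g (X i \<omega>)) {..<n}"
    using indep g by (rule indep_vars_compose2)
  have "distr P L (\<lambda>\<omega>. g (X i \<omega>)) = distr (distr P N (X i)) L g" if "i < n" for i
  proof -
    have "X i \<in> measurable P N"
      using indep that by (auto simp: indep_vars_def)
    then show ?thesis
      using g by (simp add: distr_distr comp_def)
  qed
  then have "distr P L (\<lambda>\<omega>. g (X i \<omega>)) = distr P L (\<lambda>\<omega>. g (X j \<omega>))" if "i < n" "j < n" for i j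
    using that distr[OF that] by metis
  with indep_g show ?thesis
    unfolding iid_vars_def by blast
qed

lemma distributed_AE_support:
  assumes "distributed P \<nu> Y (\<lambda>x. ennreal (h x))"
    and "\<And>x. x \<in> space \<nu> \<Longrightarrow> x \<notin> B \<Longrightarrow> h x = 0" and [measurable]: "B \<in> sets \<nu>"
  shows "AE \<omega> in P. Y \<omega> \<in> B"
proof -
  have [measurable]: "(\<lambda>x. ennreal (h x)) \<in> borel_measurable \<nu>" "Y \<in> measurable P \<nu>"
    and distr: "distr P \<nu> Y = density \<nu> (\<lambda>x. ennreal (h x))"
    using assms(1) by (auto simp: distributed_def)
  have "AE x in density \<nu> (\<lambda>x. ennreal (h x)). x \<in> B"
    by (subst AE_density) (use assms(2) in \<open>auto intro!: AE_I2 intro: ccontr\<close>)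
  then show ?thesis
    unfolding distr[symmetric] by (rule AE_distrD[rotated]) measurable
qed

theorem proposition3p1:
  fixes a b :: ereal and \<Theta> :: "real set"
    and \<nu> :: "'x measure" and f :: "real \<Rightarrow> 'x \<Rightarrow> real"
    and k A :: "real \<Rightarrow> real" and T S :: "'x \<Rightarrow> real" and B :: "'x set"
    and P :: "'w measure" and X :: "nat \<Rightarrow> 'w \<Rightarrow> 'x" and n :: nat and \<theta>\<^sub>0 :: real
  assumes "a < b" and "\<Theta> = einterval a b"
    and "exponential_family \<nu> f \<Theta> k A T S B"
    and "\<forall>\<theta>\<in>\<Theta>. deriv k \<theta> \<noteq> 0"
    and "prob_space P" and "n \<ge> 1" and "\<theta>\<^sub>0 \<in> \<Theta>"
    and "iid_vars P \<nu> n X"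
    and "\<forall>i<n. distributed P \<nu> (X i) (\<lambda>x. ennreal (f \<theta>\<^sub>0 x))"
    and "cond_A1 f a b B n" and "cond_A2 f a b B n" and "cond_A3 f a b B n"
    and "cond_R1 \<nu> f \<Theta>" and "cond_R2 \<nu> f \<Theta>" and "cond_R3 \<nu> f \<Theta> B" and "cond_R4 \<nu> f \<Theta>"
    and "inj_on (D_map k A) \<Theta>"
  shows "(\<forall>x \<in> {..<n} \<rightarrow> B. \<exists>!\<theta>. is_mle f \<Theta> n x \<theta>) \<and>
    inj_on (D_map k A) \<Theta> \<and>
    times_differentiable_on 2 (D_map k A) \<Theta> \<and>
    (\<forall>\<theta>\<in>\<Theta>. deriv (D_map k A) \<theta> \<noteq> 0) \<and>
    iid_vars P borel n (\<lambda>i \<omega>. T (X i \<omega>)) \<and>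
    (AE \<omega> in P. (\<forall>i<n. X i \<omega> \<in> B) \<and>
       D_map k A (mle f \<Theta> n (\<lambda>i. X i \<omega>)) = (\<Sum>i<n. T (X i \<omega>)) / real n)"
proof -
  note fam = \<open>exponential_family \<nu> f \<Theta> k A T S B\<close> and R2 = \<open>cond_R2 \<nu> f \<Theta>\<close>
  note inj = \<open>inj_on (D_map k A) \<Theta>\<close>
  have nz: "deriv k \<theta> \<noteq> 0" if "\<theta> \<in> \<Theta>" for \<theta>
    using that \<open>\<forall>\<theta>\<in>\<Theta>. deriv k \<theta> \<noteq> 0\<close> by blast
  have "open \<Theta>"
    using \<open>\<Theta> = einterval a b\<close> by simp
  \<comment> \<open>Identifiability has content only because there is a second parameter value.\<close>
  obtain e where "e > 0" "ball \<theta>\<^sub>0 e \<subseteq> \<Theta>"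
    using \<open>open \<Theta>\<close> \<open>\<theta>\<^sub>0 \<in> \<Theta>\<close> openE by blast
  then have \<theta>\<^sub>1: "\<theta>\<^sub>0 + e / 2 \<in> \<Theta>" "\<theta>\<^sub>0 \<noteq> \<theta>\<^sub>0 + e / 2"
    by (auto simp: dist_real_def)
  have "times_differentiable_on 3 (\<lambda>t. f t x) \<Theta>" if "x \<in> B" for x
    using R2 exponential_family_support(1)[OF fam \<open>\<theta>\<^sub>0 \<in> \<Theta>\<close>] that unfolding cond_R2_def by blast
  then have k3: "times_differentiable_on 3 k \<Theta>" and A3: "times_differentiable_on 3 A \<Theta>"
    using exponential_family_parameters_smooth
      [OF fam \<open>open \<Theta>\<close> \<open>cond_R1 \<nu> f \<Theta>\<close> _ \<open>\<theta>\<^sub>0 \<in> \<Theta>\<close> \<theta>\<^sub>1] by blast+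
  then have k: "times_differentiable_on 2 k \<Theta>" and A: "times_differentiable_on 2 A \<Theta>"
    by (auto elim: times_differentiable_on_le)
  have "times_differentiable_on 2 (deriv k) \<Theta>" "times_differentiable_on 2 (deriv A) \<Theta>"
    using k3 A3 by (simp_all add: numeral_3_eq_3 numeral_2_eq_2 times_differentiable_on_Suc)
  then have smooth: "times_differentiable_on 2 (D_map k A) \<Theta>"
    unfolding D_map_def[abs_def] divide_inverse using nz
    by (intro times_differentiable_on_mult times_differentiable_on_inverse \<open>open \<Theta>\<close>)
  have D': "deriv (D_map k A) \<theta> \<noteq> 0" if "\<theta> \<in> \<Theta>" for \<theta>
    using deriv_D_map_eq_fisher_info[OF fam \<open>open \<Theta>\<close> k A R2 that nz[OF that]] nz[OF that]
      \<open>cond_R4 \<nu> f \<Theta>\<close> that unfolding cond_R4_def by fastforce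

  have equation: "D_map k A \<theta> = (\<Sum>i<n. T (x i)) / real n"
    if "x \<in> {..<n} \<rightarrow> B" "is_mle f \<Theta> n x \<theta>" for x \<theta>
    using exponential_family_likelihood_equation[OF fam \<open>open \<Theta>\<close> k A that(1) \<open>n \<ge> 1\<close> that(2) nz]
      that(2) by (auto simp: is_mle_def is_arg_max_linorder)
  have exist: "\<exists>\<theta>. is_mle f \<Theta> n x \<theta>" if x: "x \<in> {..<n} \<rightarrow> B" for x
    unfolding is_mle_def \<open>\<Theta> = einterval a b\<close>
  proof (rule einterval_attains_max)
    have "times_differentiable_on 2 (log_lik f n x) (einterval a b)"
      using bspec[OF \<open>cond_A1 f a b B n\<close>[unfolded cond_A1_def] x] by (rule conjunct1)
    then show "continuous_on (einterval a b) (log_lik f n x)"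
      by (rule DERIV_continuous_on[OF has_field_derivative_at_within
            [OF times_differentiable_on_imp_DERIV[OF _ zero_less_numeral]]])
    show "\<theta>\<^sub>0 \<in> einterval a b"
      using \<open>\<theta>\<^sub>0 \<in> \<Theta>\<close> \<open>\<Theta> = einterval a b\<close> by simp
    show "filterlim (log_lik f n x \<circ> real_of_ereal) at_bot (at_right a)"
      "filterlim (log_lik f n x \<circ> real_of_ereal) at_bot (at_left b)"
      using bspec[OF \<open>cond_A2 f a b B n\<close>[unfolded cond_A2_def] x]
      by (rule conjunct1, rule conjunct2)
  qed
  \<comment> \<open>\<open>D\<close> takes the same value at any two maximizers, and it is injective.\<close>
  have unique: "\<exists>!\<theta>. is_mle f \<Theta> n x \<theta>" if x: "x \<in> {..<n} \<rightarrow> B" for x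
  proof (rule ex_ex1I[OF exist[OF x]])
    fix \<theta> \<theta>' assume max: "is_mle f \<Theta> n x \<theta>" "is_mle f \<Theta> n x \<theta>'"
    then have "\<theta> \<in> \<Theta>" "\<theta>' \<in> \<Theta>"
      by (auto simp: is_mle_def is_arg_max_linorder)
    then show "\<theta> = \<theta>'"
      using equation[OF x max(1)] equation[OF x max(2)] by (simp add: inj_onD[OF inj])
  qed

  have "T \<in> borel_measurable \<nu>"
    using fam by (simp add: exponential_family_def)
  then have iid: "iid_vars P borel n (\<lambda>i \<omega>. T (X i \<omega>))"
    by (rule iid_vars_compose[OF \<open>prob_space P\<close> \<open>iid_vars P \<nu> n X\<close>])
  have "AE \<omega> in P. X i \<omega> \<in> B" if "i < n" for i
  proof (rule distributed_AE_support)
    show "distributed P \<nu> (X i) (\<lambda>x. ennreal (f \<theta>\<^sub>0 x))"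
      using \<open>\<forall>i<n. distributed P \<nu> (X i) (\<lambda>x. ennreal (f \<theta>\<^sub>0 x))\<close> that by blast
    show "f \<theta>\<^sub>0 x = 0" if "x \<in> space \<nu>" "x \<notin> B" for x
      using exponential_family_density[OF fam \<open>\<theta>\<^sub>0 \<in> \<Theta>\<close>] that by simp
    show "B \<in> sets \<nu>"
      using exponential_family_support(2)[OF fam \<open>\<theta>\<^sub>0 \<in> \<Theta>\<close>] .
  qed
  then have "AE \<omega> in P. \<forall>i\<in>{..<n}. X i \<omega> \<in> B"
    by (intro AE_finite_allI) auto
  then have "AE \<omega> in P. (\<forall>i<n. X i \<omega> \<in> B) \<and>
      D_map k A (mle f \<Theta> n (\<lambda>i. X i \<omega>)) = (\<Sum>i<n. T (X i \<omega>)) / real n"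
  proof eventually_elim
    case (elim \<omega>)
    then have x: "(\<lambda>i. X i \<omega>) \<in> {..<n} \<rightarrow> B"
      by auto
    \<comment> \<open>\<open>mle\<close> is a choice among the maximizers, meaningful once one exists.\<close>
    have "is_mle f \<Theta> n (\<lambda>i. X i \<omega>) (mle f \<Theta> n (\<lambda>i. X i \<omega>))"
      using someI_ex[OF exist[OF x]] by (simp add: is_mle_def mle_def arg_max_def)
    then show ?case
      using equation[OF x] elim by auto
  qed
  with unique inj smooth D' iid show ?thesis
    by blast
qed

end
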